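(* Let $K\in\mathbb{N}$ be finite, let $\phi_1,\dots,\phi_K:\Omega\to\mathbb{R}$ be functions (the moment functions), and let $\mathbf{W}\in\mathbb{R}^{K\times K}$ be a symmetric positive-definite weight matrix. Let $$\mathcal{F}_D=\Big\{f(x)=\sum_{k=1}^K\omega_k\phi_k(x)\ :\ \omega\in\mathbb{R}^K,\ \omega^\top\mathbf{W}^{-1}\omega\le1\Big\}.$$ Let $\mathcal{D}_G$ be any class of probability distributions on $\Omega$, let $X_1,\dots,X_n$ be i.i.d. from $\nu$ with empirical distribution $\widehat\nu^n=\frac1n\sum_{i=1}^n\delta_{X_i}$, and let $$\widehat\mu_n\in\operatorname*{arg\,min}_{\mu\in\mathcal{D}_G}\ \max_{f\in\mathcal{F}_D}\Big\{\mathbb{E}_{Y\sim\mu}f(Y)-\mathbb{E}_{X\sim\widehat\nu^n}f(X)\Big\}.$$ Then $\widehat\mu_n$ implements the Generalized Method of Moments with weight matrix $\mathbf{W}$, i.e., with $\Phi=(\phi_1,\dots,\phi_K)^\top$, $$\widehat\mu_n\in\operatorname*{arg\,min}_{\mu\in\mathcal{D}_G}\big(\mathbb{E}_{Y\sim\mu}\Phi(Y)-\mathbb{E}_{X\sim\widehat\nu^n}\Phi(X)\big)^\top\mathbf{W}\big(\mathbb{E}_{Y\sim\mu}\Phi(Y)-\mathbb{E}_{X\sim\widehat\nu^n}\Phi(X)\big).$$ In addition, $$\mathbb{E}\,d_{\mathcal{F}_D}(\widehat\mu_n,\nu)\ \le\ \min_{\mu\in\mathcal{D}_G}d_{\ma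thcal{F}_D}(\mu,\nu)+4\sqrt{\frac{\mathbb{E}_{X\sim\nu}\big[\sum_{i,j=1}^K\mathbf{W}_{ij}\phi_i(X)\phi_j(X)\big]}{n}}.$$
   Context: For a symmetric function class $\mathcal{F}$, $d_{\mathcal{F}}(\mu,\nu)=\sup_{f\in\mathcal{F}}\{\mathbb{E}_{Y\sim\mu}f(Y)-\mathbb{E}_{X\sim\nu}f(X)\}$. The outer expectation is over the samples $X_1,\dots,X_n$. *)

theory Defs
  imports "HOL-Probability.Probability"
begin

text \<open>The supremum is taken in the extended reals, so no boundedness of the class is presupposed.\<close>

definition ipm :: "('a \<Rightarrow> real) set \<Rightarrow> 'a measure \<Rightarrow> 'a measure \<Rightarrow> ereal" where
  "ipm F \<mu> \<nu> = (SUP f\<in>F. ereal ((\<integral>y. f y \<partial>\<mu>) - (\<integral>x. f x \<partial>\<nu>)))"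

definition empirical :: "'a measure \<Rightarrow> nat \<Rightarrow> (nat \<Rightarrow> 'a) \<Rightarrow> 'a measure" where
  "empirical \<Omega> n x =
     measure_of (space \<Omega>) (sets \<Omega>) (\<lambda>A. (\<Sum>i<n. emeasure (return \<Omega> (x i)) A) / of_nat n)"

definition pos_def_matrix :: "real^'k^'k \<Rightarrow> bool" where
  "pos_def_matrix W \<longleftrightarrow> transpose W = W \<and> (\<forall>v. v \<noteq> 0 \<longrightarrow> v \<bullet> (W *v v) > 0)"

definition moment_class :: "real^'k^'k \<Rightarrow> ('k::finite \<Rightarrow> 'a \<Rightarrow> real) \<Rightarrow> ('a \<Rightarrow> real) set" where
  "moment_class W \<phi> =
     {f. \<exists>\<omega>::real^'k. f = (\<lambda>x. \<Sum>k\<in>UNIV. \<omega> $ k * \<phi> k x) \<and> \<omega> \<bullet> (matrix_inv W *v \<omega>) \<le> 1}"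

definition moment_vector :: "('k::finite \<Rightarrow> 'a \<Rightarrow> real) \<Rightarrow> 'a \<Rightarrow> real^'k" where
  "moment_vector \<phi> x = (\<chi> k. \<phi> k x)"

definition gmm_objective ::
    "real^'k^'k \<Rightarrow> ('k::finite \<Rightarrow> 'a \<Rightarrow> real) \<Rightarrow> 'a measure \<Rightarrow> 'a measure \<Rightarrow> real" where
  "gmm_objective W \<phi> \<mu> \<nu> =
     (let v = (\<integral>y. moment_vector \<phi> y \<partial>\<mu>) - (\<integral>x. moment_vector \<phi> x \<partial>\<nu>) in v \<bullet> (W *v v))"

definition ennreal_sqrt :: "ennreal \<Rightarrow> ennreal" where
  "ennreal_sqrt x = (if x = \<top> then \<top> else ennreal (sqrt (enn2real x)))"

lemma empirical_eq_distr:
  assumes "0 < n" and x: "\<And>i. i < n \<Longrightarrow> x i \<in> space \<Omega>"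
  shows "empirical \<Omega> n x = distr (uniform_count_measure {..<n}) \<Omega> x"
proof -
  let ?N = "distr (uniform_count_measure {..<n}) \<Omega> x"
  have m: "x \<in> measurable (uniform_count_measure {..<n}) \<Omega>"
    using x by (auto simp: measurable_def space_uniform_count_measure sets_uniform_count_measure)
  have "(\<Sum>i<n. emeasure (return \<Omega> (x i)) A) / of_nat n = emeasure ?N A" if A: "A \<in> sets \<Omega>" for A
  proof -
    have "emeasure ?N A = ennreal (real (card (x -` A \<inter> {..<n})) / real n)"
      using A m by (simp add: emeasure_distr emeasure_uniform_count_measure space_uniform_count_measure)
    also have "\<dots> = of_nat (card (x -` A \<inter> {..<n})) / of_nat n"
      using \<open>0 < n\<close> by (simp flip: divide_ennreal add: ennreal_of_nat_eq_real_of_nat)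
    also have "of_nat (card (x -` A \<inter> {..<n})) = (\<Sum>i<n. indicator A (x i) :: ennreal)"
      by (simp add: indicator_def Int_def vimage_def sum.If_cases conj_commute)
    finally show ?thesis using A by simp
  qed
  then have "empirical \<Omega> n x = measure_of (space \<Omega>) (sets \<Omega>) (emeasure ?N)"
    unfolding empirical_def
    by (intro measure_of_eq sets.space_closed) (simp add: sets.sigma_sets_eq)
  then show ?thesis
    using measure_of_of_measure[of ?N] by simp
qed

end

theory Submission
  imports Defs
begin

text \<open>
  Everything rests on the norm \<open>\<parallel>v\<parallel> = sqrt (v\<^sup>T W v)\<close> on moment vectors. Its dual unit ball is
  \<open>{\<omega>. \<omega>\<^sup>T W\<^sup>-\<^sup>1 \<omega> \<le> 1}\<close>, which is exactly the coefficient set of the discriminators. Since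
  discriminators are linear in the moment functions, the integral probability metric of two
  distributions with finite moments is the norm of the difference of their moment vectors
  (\<open>ipm_moment_class\<close>). The generalized-moments objective is the square of this number, and
  squaring is monotone on nonnegative reals, so both objectives have the same minimizers.

  For the risk bound, let \<open>Z\<close> be the norm of the difference between the empirical moment vector
  and the true one. The estimator is at least as close to the empirical moments as any competitor
  \<open>\<mu>\<close>, so two triangle inequalities bound its distance to the truth by that of \<open>\<mu>\<close> plus \<open>2 * Z\<close>
  (\<open>wnorm_minimizer_excess\<close>). It remains to bound the expectation of \<open>Z\<close>. Because the norm comes
  from an inner product, this is a variance computation: the centred moment vectors of distinct
  samples are orthogonal in expectation, so the second moment of their sum is the sum of their
  second moments, and centring only decreases a second moment. Hence \<open>Z\<^sup>2\<close> has expectation at most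
  \<open>1/n\<close> times the second moment of \<open>\<Phi>(X)\<close>, and Jensen's inequality gives the square root
  (\<open>expectation_wnorm_empirical_mean\<close>). This yields the bound with the factor 2, hence with 4.

  If the second moment is infinite, then so is the right-hand side. If it is finite, the
  inequality \<open>component_power2_le_form\<close> shows that each moment function is square integrable,
  so all the moments above exist.
\<close>

section \<open>The norm of a positive definite matrix\<close>

definition wnorm :: "real^'k^'k \<Rightarrow> real^'k \<Rightarrow> real" where
  "wnorm W v = sqrt (v \<bullet> (W *v v))"

lemma pos_def_matrix_sym:
  assumes "pos_def_matrix W"
  shows "u \<bullet> (W *v v) = v \<bullet> (W *v u)"
proof -
  have "u \<bullet> (W *v v) = (transpose W *v u) \<bullet> v"
    by (simp add: dot_lmul_matrix)
  also have "\<dots> = v \<bullet> (W *v u)"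
    using assms by (simp add: pos_def_matrix_def inner_commute del: transpose_matrix_vector)
  finally show ?thesis .
qed

lemma pos_def_matrix_form_nonneg:
  assumes "pos_def_matrix W"
  shows "0 \<le> v \<bullet> (W *v v)"
  using assms by (cases "v = 0") (auto simp: pos_def_matrix_def less_imp_le)

lemma wnorm_nonneg: "pos_def_matrix W \<Longrightarrow> 0 \<le> wnorm W v"
  by (simp add: wnorm_def pos_def_matrix_form_nonneg)

lemma wnorm_power2: "pos_def_matrix W \<Longrightarrow> (wnorm W v)\<^sup>2 = v \<bullet> (W *v v)"
  by (simp add: wnorm_def pos_def_matrix_form_nonneg)

lemma wnorm_minus_commute: "wnorm W (u - v) = wnorm W (v - u)"
  by (simp add: wnorm_def algebra_simps inner_diff_left inner_diff_right)

lemma wnorm_scaleR: "wnorm W (c *\<^sub>R v) = \<bar>c\<bar> * wnorm W v"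
proof -
  have "wnorm W (c *\<^sub>R v) = sqrt (c\<^sup>2 * (v \<bullet> (W *v v)))"
    by (simp add: wnorm_def matrix_vector_mult_scaleR power2_eq_square mult_ac)
  then show ?thesis by (simp add: wnorm_def real_sqrt_mult)
qed

lemma borel_measurable_wnorm [measurable]: "wnorm W \<in> borel_measurable borel"
  unfolding wnorm_def[abs_def]
  by (intro borel_measurable_continuous_onI continuous_intros linear_continuous_on
      linear_conv_bounded_linear[THEN iffD1] matrix_vector_mul_linear)

lemma pos_def_matrix_form_diff:
  assumes "pos_def_matrix W"
  shows "(u - v) \<bullet> (W *v (u - v)) = u \<bullet> (W *v u) - 2 * (u \<bullet> (W *v v)) + v \<bullet> (W *v v)"
  using pos_def_matrix_sym[OF assms, of u v]
  by (simp add: algebra_simps inner_diff_left inner_diff_right)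

text \<open>
  The form is nonnegative at \<open>\<parallel>v\<parallel> u - \<parallel>u\<parallel> v\<close>; dividing by \<open>2 \<parallel>u\<parallel> \<parallel>v\<parallel>\<close> gives the claim.
\<close>

lemma wnorm_Cauchy_Schwarz:
  assumes "pos_def_matrix W"
  shows "u \<bullet> (W *v v) \<le> wnorm W u * wnorm W v"
proof (cases "wnorm W u = 0 \<or> wnorm W v = 0")
  case True
  then have "u = 0 \<or> v = 0"
    using assms by (auto simp: wnorm_def pos_def_matrix_def)
  then show ?thesis by (auto simp: wnorm_def)
next
  case False
  let ?a = "wnorm W u" and ?b = "wnorm W v"
  have pos: "?a > 0" "?b > 0"
    using False wnorm_nonneg[OF assms, of u] wnorm_nonneg[OF assms, of v] by auto
  have "0 \<le> (?b *\<^sub>R u - ?a *\<^sub>R v) \<bullet> (W *v (?b *\<^sub>R u - ?a *\<^sub>R v))"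
    by (rule pos_def_matrix_form_nonneg[OF assms])
  also have "\<dots> = ?b\<^sup>2 * ?a\<^sup>2 - 2 * (?a * ?b * (u \<bullet> (W *v v))) + ?a\<^sup>2 * ?b\<^sup>2"
    unfolding pos_def_matrix_form_diff[OF assms] wnorm_power2[OF assms]
    by (simp add: matrix_vector_mult_scaleR power2_eq_square wnorm_power2[OF assms, symmetric])
  finally have "?a * ?b * (u \<bullet> (W *v v)) \<le> ?a * ?b * (?a * ?b)"
    by (simp add: power2_eq_square algebra_simps)
  then show ?thesis
    using pos by (metis mult_pos_pos mult_le_cancel_left_pos)
qed

lemma wnorm_triangle:
  assumes "pos_def_matrix W"
  shows "wnorm W (u - w) \<le> wnorm W (u - v) + wnorm W (v - w)"
proof -
  let ?a = "u - v" and ?b = "v - w"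
  have "(wnorm W (u - w))\<^sup>2 = (?a - (- ?b)) \<bullet> (W *v (?a - (- ?b)))"
    by (simp add: wnorm_power2[OF assms])
  also have "\<dots> = (wnorm W ?a)\<^sup>2 + 2 * (?a \<bullet> (W *v ?b)) + (wnorm W ?b)\<^sup>2"
    unfolding pos_def_matrix_form_diff[OF assms] wnorm_power2[OF assms]
    using pos_def_matrix_sym[OF assms, of v w]
    by (simp add: algebra_simps inner_diff_left inner_diff_right)
  also have "\<dots> \<le> (wnorm W ?a + wnorm W ?b)\<^sup>2"
    using wnorm_Cauchy_Schwarz[OF assms, of ?a ?b] by (simp add: power2_sum)
  finally show ?thesis
    by (rule power2_le_imp_le) (simp add: wnorm_nonneg[OF assms])
qed

lemma pos_def_matrix_inv:
  assumes "pos_def_matrix W"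
  shows "W ** matrix_inv W = mat 1" "matrix_inv W ** W = mat 1"
proof -
  have "\<forall>x. W *v x = 0 \<longrightarrow> x = 0"
    using assms unfolding pos_def_matrix_def by (metis inner_zero_right less_irrefl)
  then obtain B where "B ** W = mat 1"
    using matrix_left_invertible_ker[of W] by blast
  then have "invertible W"
    by (metis invertible_def matrix_left_right_inverse)
  then have "\<exists>A'. W ** A' = mat 1 \<and> A' ** W = mat 1"
    by (simp add: invertible_def)
  then show "W ** matrix_inv W = mat 1" "matrix_inv W ** W = mat 1"
    unfolding matrix_inv_def by (metis (mono_tags, lifting) someI_ex)+
qed

text \<open>
  The substitution \<open>\<omega> = W \<eta>\<close> turns the form of the inverse matrix into that of \<open>W\<close>, so that
  duality for the ellipsoid reduces to the Cauchy-Schwarz inequality for \<open>W\<close> alone.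
\<close>

lemma dual_ball_eq_image:
  assumes "pos_def_matrix W"
  shows "{\<omega>. \<omega> \<bullet> (matrix_inv W *v \<omega>) \<le> 1} = (\<lambda>\<eta>. W *v \<eta>) ` {\<eta>. wnorm W \<eta> \<le> 1}"
proof -
  note inv = pos_def_matrix_inv[OF assms]
  have W_inv: "W *v (matrix_inv W *v \<omega>) = \<omega>" for \<omega>
    by (simp add: matrix_vector_mul_assoc inv)
  have inv_W: "(W *v \<eta>) \<bullet> (matrix_inv W *v (W *v \<eta>)) = \<eta> \<bullet> (W *v \<eta>)" for \<eta>
    by (simp add: matrix_vector_mul_assoc inv inner_commute)
  have "(W *v \<eta>) \<bullet> (matrix_inv W *v (W *v \<eta>)) \<le> 1 \<longleftrightarrow> wnorm W \<eta> \<le> 1" for \<eta>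
    by (simp add: inv_W wnorm_def)
  then show ?thesis
    by (auto simp: image_iff) (metis W_inv)+
qed

text \<open>
  Cauchy-Schwarz gives the upper bound, and the normalized direction \<open>d / \<parallel>d\<parallel>\<close> attains it.
\<close>

lemma SUP_dual_ball:
  assumes "pos_def_matrix W"
  shows "(SUP \<omega>\<in>{\<omega>. \<omega> \<bullet> (matrix_inv W *v \<omega>) \<le> 1}. ereal (\<omega> \<bullet> d)) = ereal (wnorm W d)"
proof -
  have swap: "(W *v \<eta>) \<bullet> d = \<eta> \<bullet> (W *v d)" for \<eta>
    using pos_def_matrix_sym[OF assms, of d \<eta>] by (simp add: inner_commute)
  have "(SUP \<eta>\<in>{\<eta>. wnorm W \<eta> \<le> 1}. ereal (\<eta> \<bullet> (W *v d))) = ereal (wnorm W d)"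
  proof (rule antisym)
    show "(SUP \<eta>\<in>{\<eta>. wnorm W \<eta> \<le> 1}. ereal (\<eta> \<bullet> (W *v d))) \<le> ereal (wnorm W d)"
    proof (rule SUP_least)
      fix \<eta> assume "\<eta> \<in> {\<eta>. wnorm W \<eta> \<le> 1}"
      then have "wnorm W \<eta> * wnorm W d \<le> 1 * wnorm W d"
        by (intro mult_right_mono wnorm_nonneg[OF assms]) simp
      then show "ereal (\<eta> \<bullet> (W *v d)) \<le> ereal (wnorm W d)"
        using wnorm_Cauchy_Schwarz[OF assms, of \<eta> d] by simp
    qed
    \<comment> \<open>The unit vector in the direction of \<open>d\<close>; for \<open>d = 0\<close> division by zero makes it zero.\<close>
    let ?\<eta> = "inverse (wnorm W d) *\<^sub>R d"
    have form: "?\<eta> \<bullet> (W *v d) = wnorm W d"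
      using wnorm_power2[OF assms, of d]
      by (cases "wnorm W d = 0") (auto simp: power2_eq_square field_simps)
    have "wnorm W ?\<eta> \<le> 1"
    proof -
      have "(wnorm W ?\<eta>)\<^sup>2 = inverse (wnorm W d) * (?\<eta> \<bullet> (W *v d))"
        by (simp add: wnorm_power2[OF assms] matrix_vector_mult_scaleR)
      also have "\<dots> \<le> 1\<^sup>2" unfolding form by (cases "wnorm W d = 0") simp_all
      finally show ?thesis by (rule power2_le_imp_le) simp
    qed
    then show "ereal (wnorm W d) \<le> (SUP \<eta>\<in>{\<eta>. wnorm W \<eta> \<le> 1}. ereal (\<eta> \<bullet> (W *v d)))"
      by (intro SUP_upper2[of ?\<eta>]) (simp_all add: form[simplified])
  qed
  then show ?thesis
    by (simp add: dual_ball_eq_image[OF assms] image_image swap)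
qed

text \<open>
  This is Cauchy-Schwarz against \<open>\<eta> = W\<^sup>-\<^sup>1 e\<^sub>k\<close>, since \<open>v \<bullet> (W *v \<eta>)\<close> is the \<open>k\<close>-th component of \<open>v\<close>.
  It passes integrability from the quadratic form to each single component.
\<close>

lemma component_power2_le_form:
  fixes W :: "real^'k^'k" and v :: "real^'k"
  assumes "pos_def_matrix W"
  shows "(v $ k)\<^sup>2 \<le> (matrix_inv W $ k $ k) * (v \<bullet> (W *v v))"
proof -
  let ?e = "axis k 1 :: real^'k"
  let ?\<eta> = "matrix_inv W *v ?e"
  have W\<eta>: "W *v ?\<eta> = ?e"
    by (simp add: matrix_vector_mul_assoc pos_def_matrix_inv[OF assms])
  have \<eta>: "?\<eta> \<bullet> (W *v ?\<eta>) = matrix_inv W $ k $ k"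
    unfolding W\<eta> by (simp add: inner_axis matrix_vector_mult_basis column_def)
  have comp: "u $ k = u \<bullet> (W *v ?\<eta>)" for u
    by (simp add: W\<eta> inner_axis)
  have "v $ k \<le> wnorm W v * wnorm W ?\<eta>"
    unfolding comp by (rule wnorm_Cauchy_Schwarz[OF assms])
  moreover have "- (v $ k) \<le> wnorm W v * wnorm W ?\<eta>"
    using wnorm_Cauchy_Schwarz[OF assms, of "-v" ?\<eta>]
    unfolding comp by (simp add: wnorm_minus_commute[of W 0, simplified])
  ultimately have "\<bar>v $ k\<bar> \<le> wnorm W v * wnorm W ?\<eta>" by linarith
  then have "(v $ k)\<^sup>2 \<le> (wnorm W v * wnorm W ?\<eta>)\<^sup>2"
    by (metis power2_abs power_mono abs_ge_zero)
  then show ?thesis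
    by (simp add: power_mult_distrib wnorm_power2[OF assms] \<eta> mult.commute)
qed

section \<open>Moments of the discriminator class\<close>

lemma moment_vector_component: "moment_vector \<phi> x $ k = \<phi> k x"
  by (simp add: moment_vector_def)

lemma moment_vector_conv_sum: "moment_vector \<phi> x = (\<Sum>k\<in>UNIV. \<phi> k x *\<^sub>R axis k 1)"
  by (simp add: vec_eq_iff moment_vector_def axis_def if_distrib sum.delta' cong: if_cong)

lemma integrable_moment_vector:
  assumes "\<And>k. integrable M (\<phi> k)"
  shows "integrable M (moment_vector \<phi>)"
  using assms unfolding moment_vector_conv_sum[abs_def] by (intro Bochner_Integration.integrable_sum) auto

lemma borel_measurable_moment_vector:
  assumes "\<And>k. \<phi> k \<in> borel_measurable M"
  shows "moment_vector \<phi> \<in> borel_measurable M"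
  using assms unfolding moment_vector_conv_sum[abs_def] by measurable

text \<open>
  Integrability of the moment functions allows the expectation to be exchanged with the linear
  combination, so the supremum runs over the pairings of the moment difference with the dual ball.
\<close>

lemma ipm_moment_class:
  assumes "pos_def_matrix W"
    and \<mu>: "\<And>k. integrable \<mu> (\<phi> k)" and \<nu>: "\<And>k. integrable \<nu> (\<phi> k)"
  shows "ipm (moment_class W \<phi>) \<mu> \<nu> =
    ereal (wnorm W ((\<integral>y. moment_vector \<phi> y \<partial>\<mu>) - (\<integral>x. moment_vector \<phi> x \<partial>\<nu>)))"
proof -
  have linear: "(\<integral>x. (\<Sum>k\<in>UNIV. \<omega> $ k * \<phi> k x) \<partial>M) = \<omega> \<bullet> (\<integral>x. moment_vector \<phi> x \<partial>M)"
    if "\<And>k. integrable M (\<phi> k)" for \<omega> and M :: "'b measure"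
  proof -
    have "(\<Sum>k\<in>UNIV. \<omega> $ k * \<phi> k x) = \<omega> \<bullet> moment_vector \<phi> x" for x
      by (simp add: inner_vec_def moment_vector_def)
    then show ?thesis
      by (simp add: integrable_moment_vector[of _ \<phi>, OF that])
  qed
  have "moment_class W \<phi> =
      (\<lambda>\<omega> x. \<Sum>k\<in>UNIV. \<omega> $ k * \<phi> k x) ` {\<omega>. \<omega> \<bullet> (matrix_inv W *v \<omega>) \<le> 1}"
    by (auto simp: moment_class_def)
  then show ?thesis
    unfolding ipm_def
    by (simp add: image_image linear[OF \<mu>] linear[OF \<nu>] SUP_dual_ball[OF assms(1)] flip: inner_diff_right)
qed

lemma gmm_objective_eq_wnorm:
  assumes "pos_def_matrix W"
  shows "gmm_objective W \<phi> \<mu> \<nu> =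
    (wnorm W ((\<integral>y. moment_vector \<phi> y \<partial>\<mu>) - (\<integral>x. moment_vector \<phi> x \<partial>\<nu>)))\<^sup>2"
  by (simp add: gmm_objective_def Let_def wnorm_power2[OF assms])

lemma moment_form_eq_sum:
  "moment_vector \<phi> x \<bullet> (W *v moment_vector \<phi> x) = (\<Sum>i\<in>UNIV. \<Sum>j\<in>UNIV. W $ i $ j * \<phi> i x * \<phi> j x)"
  by (simp add: inner_vec_def matrix_vector_mult_def moment_vector_def sum_distrib_left mult_ac)

section \<open>Empirical means\<close>

lemma
  fixes f :: "'a \<Rightarrow> 'c::{banach, second_countable_topology}"
  assumes "0 < n" and x: "\<And>i. i < n \<Longrightarrow> x i \<in> space \<Omega>" and f: "f \<in> borel_measurable \<Omega>"
  shows integrable_empirical: "integrable (empirical \<Omega> n x) f"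
    and integral_empirical: "(\<integral>y. f y \<partial>empirical \<Omega> n x) = (\<Sum>i<n. f (x i)) /\<^sub>R real n"
proof -
  have m: "x \<in> measurable (uniform_count_measure {..<n}) \<Omega>"
    using x by (auto simp: measurable_def space_uniform_count_measure sets_uniform_count_measure)
  have eq: "empirical \<Omega> n x = distr (uniform_count_measure {..<n}) \<Omega> x"
    by (rule empirical_eq_distr) (use assms in auto)
  show "integrable (empirical \<Omega> n x) f"
    unfolding eq by (subst integrable_distr_eq[OF m f])
      (simp add: uniform_count_measure_def integrable_point_measure_finite)
  show "(\<integral>y. f y \<partial>empirical \<Omega> n x) = (\<Sum>i<n. f (x i)) /\<^sub>R real n"
    unfolding eq by (subst integral_distr[OF m f])
      (simp add: uniform_count_measure_def lebesgue_integral_point_measure_finite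
        scaleR_sum_right inverse_eq_divide)
qed

text \<open>
  The Pythagorean theorem for random vectors that are orthogonal in expectation with respect to
  the inner product of \<open>W\<close>.
\<close>

lemma (in prob_space) expectation_sum_power2_orthogonal:
  fixes Y :: "'i \<Rightarrow> 'a \<Rightarrow> real^'k::finite"
  assumes W: "pos_def_matrix W" and "finite I"
    and int: "\<And>a b. a \<in> I \<Longrightarrow> b \<in> I \<Longrightarrow> integrable M (\<lambda>s. Y a s \<bullet> (W *v Y b s))"
    and orth: "\<And>a b. a \<in> I \<Longrightarrow> b \<in> I \<Longrightarrow> a \<noteq> b \<Longrightarrow> expectation (\<lambda>s. Y a s \<bullet> (W *v Y b s)) = 0"
  shows "integrable M (\<lambda>s. (wnorm W (\<Sum>a\<in>I. Y a s))\<^sup>2)"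
    and "expectation (\<lambda>s. (wnorm W (\<Sum>a\<in>I. Y a s))\<^sup>2) = (\<Sum>a\<in>I. expectation (\<lambda>s. (wnorm W (Y a s))\<^sup>2))"
proof -
  have expand: "(wnorm W (\<Sum>a\<in>I. Y a s))\<^sup>2 = (\<Sum>a\<in>I. \<Sum>b\<in>I. Y a s \<bullet> (W *v Y b s))" for s
    by (simp add: wnorm_power2[OF W] vec.linear_sum[OF matrix_vector_mul_linear_gen]
        inner_sum_left inner_sum_right) (rule sum.swap)
  show "integrable M (\<lambda>s. (wnorm W (\<Sum>a\<in>I. Y a s))\<^sup>2)"
    unfolding expand by (intro Bochner_Integration.integrable_sum int)
  have "expectation (\<lambda>s. (wnorm W (\<Sum>a\<in>I. Y a s))\<^sup>2)
      = (\<Sum>a\<in>I. \<Sum>b\<in>I. expectation (\<lambda>s. Y a s \<bullet> (W *v Y b s)))"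
    unfolding expand by (simp add: int)
  also have "\<dots> = (\<Sum>a\<in>I. \<Sum>b\<in>I. if a = b then expectation (\<lambda>s. Y a s \<bullet> (W *v Y a s)) else 0)"
    by (intro sum.cong refl) (auto simp: orth)
  also have "\<dots> = (\<Sum>a\<in>I. expectation (\<lambda>s. (wnorm W (Y a s))\<^sup>2))"
    using \<open>finite I\<close> by (simp add: wnorm_power2[OF W])
  finally show "expectation (\<lambda>s. (wnorm W (\<Sum>a\<in>I. Y a s))\<^sup>2) = (\<Sum>a\<in>I. expectation (\<lambda>s. (wnorm W (Y a s))\<^sup>2))" .
qed

text \<open>
  The form is a combination of the products of a component of one vector with a component of the
  other. Independence makes each product of integrable factors integrable and its expectation
  factorize.
\<close>

lemma (in prob_space) expectation_form_indep_centered: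
  fixes \<psi> :: "'k::finite \<Rightarrow> 'b \<Rightarrow> real" and W :: "real^'k^'k"
  assumes indep: "indep_vars (\<lambda>_. \<Omega>) X I" and ab: "a \<in> I" "b \<in> I" "a \<noteq> b"
    and \<psi>: "\<And>k. \<psi> k \<in> borel_measurable \<Omega>"
    and int: "\<And>k i. i \<in> {a, b} \<Longrightarrow> integrable M (\<lambda>s. \<psi> k (X i s))"
    and mean: "\<And>k. expectation (\<lambda>s. \<psi> k (X a s)) = 0"
  shows "integrable M (\<lambda>s. moment_vector \<psi> (X a s) \<bullet> (W *v moment_vector \<psi> (X b s)))" (is "integrable M ?f")
    and "expectation (\<lambda>s. moment_vector \<psi> (X a s) \<bullet> (W *v moment_vector \<psi> (X b s))) = 0"
proof -
  have prod: "integrable M (\<lambda>s. \<psi> i (X a s) * \<psi> j (X b s))"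
    "expectation (\<lambda>s. \<psi> i (X a s) * \<psi> j (X b s)) = 0" for i j
  proof -
    \<comment> \<open>Applying \<open>\<psi> i\<close> to sample \<open>a\<close> and \<open>\<psi> j\<close> to sample \<open>b\<close> in one family, as joint
      independence is stable only under maps of single samples.\<close>
    let ?Y = "\<lambda>c s. (if c = a then \<psi> i else \<psi> j) (X c s)"
    have ind: "indep_vars (\<lambda>_. borel) ?Y {a, b}"
      by (rule indep_vars_compose2[OF indep_vars_subset[OF indep]]) (use ab \<psi> in auto)
    have int': "integrable M (?Y c)" if "c \<in> {a, b}" for c
      using int that by auto
    show "integrable M (\<lambda>s. \<psi> i (X a s) * \<psi> j (X b s))"
      using indep_vars_integrable[OF _ ind int'] ab by simp
    show "expectation (\<lambda>s. \<psi> i (X a s) * \<psi> j (X b s)) = 0"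
      using indep_vars_lebesgue_integral[OF _ ind int'] ab by (simp add: mean)
  qed
  have expand: "?f = (\<lambda>s. \<Sum>i\<in>UNIV. \<Sum>j\<in>UNIV. W $ i $ j * (\<psi> i (X a s) * \<psi> j (X b s)))"
    by (simp add: fun_eq_iff inner_vec_def matrix_vector_mult_def moment_vector_def sum_distrib_left mult_ac)
  show "integrable M ?f"
    unfolding expand by (intro Bochner_Integration.integrable_sum integrable_mult_right prod)
  show "expectation ?f = 0"
    unfolding expand by (simp add: prod)
qed

text \<open>
  Jensen's inequality for the square, read off from the nonnegativity of the variance.
\<close>

lemma (in prob_space) expectation_le_sqrt_second_moment:
  fixes f :: "'a \<Rightarrow> real"
  assumes f: "f \<in> borel_measurable M" "integrable M (\<lambda>x. (f x)\<^sup>2)"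
  shows "expectation f \<le> sqrt (expectation (\<lambda>x. (f x)\<^sup>2))"
proof -
  have "0 \<le> expectation (\<lambda>x. (f x)\<^sup>2) - (expectation f)\<^sup>2"
    using variance_eq[OF square_integrable_imp_integrable[OF f] f(2)] variance_positive[of f] by simp
  then show ?thesis by (intro real_le_rsqrt) simp
qed

lemma (in prob_space) integrable_of_form:
  assumes W: "pos_def_matrix W" and \<phi>: "\<And>k. \<phi> k \<in> borel_measurable M"
    and form: "integrable M (\<lambda>x. (wnorm W (moment_vector \<phi> x))\<^sup>2)"
  shows "integrable M (\<phi> k)"
proof (rule square_integrable_imp_integrable[OF \<phi>])
  show "integrable M (\<lambda>x. (\<phi> k x)\<^sup>2)"
  proof (rule Bochner_Integration.integrable_bound)
    show "integrable M (\<lambda>x. matrix_inv W $ k $ k * (wnorm W (moment_vector \<phi> x))\<^sup>2)"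
      by (intro integrable_mult_right form)
    have "(\<phi> k x)\<^sup>2 \<le> matrix_inv W $ k $ k * (wnorm W (moment_vector \<phi> x))\<^sup>2" for x
      using component_power2_le_form[OF W, of "moment_vector \<phi> x" k]
      by (simp add: wnorm_power2[OF W] moment_vector_def)
    then show "AE x in M. norm ((\<phi> k x)\<^sup>2) \<le> norm (matrix_inv W $ k $ k * (wnorm W (moment_vector \<phi> x))\<^sup>2)"
      by (intro AE_I2) (metis abs_ge_self abs_power2 order_trans real_norm_def)
  qed (use \<phi> in measurable)
qed

text \<open>
  The vector analogue of \<open>Var X = E X\<^sup>2 - (E X)\<^sup>2 \<le> E X\<^sup>2\<close>.
\<close>

lemma (in prob_space) variance_form_le:
  assumes W: "pos_def_matrix W" and \<phi>: "integrable M \<Phi>"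
    and form: "integrable M (\<lambda>x. (wnorm W (\<Phi> x))\<^sup>2)"
  shows "integrable M (\<lambda>x. (wnorm W (\<Phi> x - expectation \<Phi>))\<^sup>2)"
    and "expectation (\<lambda>x. (wnorm W (\<Phi> x - expectation \<Phi>))\<^sup>2) \<le> expectation (\<lambda>x. (wnorm W (\<Phi> x))\<^sup>2)"
proof -
  let ?m = "expectation \<Phi>"
  have expand: "(wnorm W (\<Phi> x - ?m))\<^sup>2 = (wnorm W (\<Phi> x))\<^sup>2 - 2 * (\<Phi> x \<bullet> (W *v ?m)) + (wnorm W ?m)\<^sup>2" for x
    by (simp add: wnorm_power2[OF W] pos_def_matrix_form_diff[OF W])
  show "integrable M (\<lambda>x. (wnorm W (\<Phi> x - ?m))\<^sup>2)"
    unfolding expand using \<phi> form by simp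
  have "expectation (\<lambda>x. (wnorm W (\<Phi> x - ?m))\<^sup>2) = expectation (\<lambda>x. (wnorm W (\<Phi> x))\<^sup>2) - (wnorm W ?m)\<^sup>2"
    unfolding expand using \<phi> form by (simp add: prob_space wnorm_power2[OF W])
  then show "expectation (\<lambda>x. (wnorm W (\<Phi> x - ?m))\<^sup>2) \<le> expectation (\<lambda>x. (wnorm W (\<Phi> x))\<^sup>2)"
    by simp
qed

text \<open>
  The sampling error of the empirical moments. With the centred moment functions \<open>\<psi>\<close>, the error
  is \<open>1/n\<close> times a sum of \<open>n\<close> vectors that are pairwise orthogonal in expectation and share the
  second moment \<open>V\<close>. The mean square error is therefore \<open>n * V / n\<^sup>2 = V / n\<close>.
\<close>

lemma (in prob_space) expectation_wnorm_empirical_mean: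
  fixes \<phi> :: "'k::finite \<Rightarrow> 'b \<Rightarrow> real"
  assumes W: "pos_def_matrix W" and n: "0 < n"
    and indep: "indep_vars (\<lambda>_. \<Omega>) X {..<n}"
    and distr: "\<And>i. i < n \<Longrightarrow> distr M \<Omega> (X i) = \<nu>"
    and \<phi>: "\<And>k. \<phi> k \<in> borel_measurable \<Omega>"
    and form: "integrable \<nu> (\<lambda>x. (wnorm W (moment_vector \<phi> x))\<^sup>2)"
  defines "m \<equiv> (\<integral>x. moment_vector \<phi> x \<partial>\<nu>)"
  defines "Z \<equiv> \<lambda>s. wnorm W ((\<Sum>i<n. moment_vector \<phi> (X i s)) /\<^sub>R real n - m)"
  shows "integrable M Z"
    and "expectation Z \<le> sqrt ((\<integral>x. (wnorm W (moment_vector \<phi> x))\<^sup>2 \<partial>\<nu>) / real n)"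
proof -
  have X [measurable]: "X i \<in> measurable M \<Omega>" if "i < n" for i
    using indep that by (auto simp: indep_vars_def)
  note \<Phi> = borel_measurable_moment_vector[of \<phi>, OF \<phi>]
  interpret \<nu>: prob_space \<nu>
    using prob_space_distr[OF X[OF n]] distr[OF n] by simp
  have \<phi>': "\<phi> k \<in> borel_measurable \<nu>" for k
    using \<phi>[of k] unfolding distr[OF n, symmetric] by simp
  have \<phi>_int: "integrable \<nu> (\<phi> k)" for k
    by (rule \<nu>.integrable_of_form[OF W \<phi>' form])
  have \<Phi>_int: "integrable \<nu> (moment_vector \<phi>)"
    by (rule integrable_moment_vector[OF \<phi>_int])
  define \<psi> where "\<psi> k x = \<phi> k x - m $ k" for k x
  have \<psi>: "\<psi> k \<in> borel_measurable \<Omega>" for k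
    unfolding \<psi>_def using \<phi>[of k] by measurable
  have \<Psi>: "moment_vector \<psi> x = moment_vector \<phi> x - m" for x
    by (simp add: moment_vector_def \<psi>_def vec_eq_iff)
  have m_nth: "m $ k = (\<integral>x. \<phi> k x \<partial>\<nu>)" for k
    using integral_inner_left[OF \<Phi>_int, of "axis k 1"]
    by (simp add: m_def inner_axis moment_vector_component)
  have \<psi>_X: "integrable M (\<lambda>s. \<psi> k (X i s))" "expectation (\<lambda>s. \<psi> k (X i s)) = 0" if "i < n" for k i
  proof -
    show "integrable M (\<lambda>s. \<psi> k (X i s))"
      using \<phi>_int[of k] unfolding integrable_distr_eq[OF X[OF that] \<psi>, symmetric] distr[OF that]
      by (simp add: \<psi>_def[abs_def])
    show "expectation (\<lambda>s. \<psi> k (X i s)) = 0"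
      using \<phi>_int[of k] unfolding integral_distr[OF X[OF that] \<psi>, symmetric] distr[OF that]
      by (simp add: \<psi>_def[abs_def] \<nu>.prob_space m_nth)
  qed
  let ?V = "\<integral>x. (wnorm W (moment_vector \<psi> x))\<^sup>2 \<partial>\<nu>" and ?S = "\<integral>x. (wnorm W (moment_vector \<phi> x))\<^sup>2 \<partial>\<nu>"
  have V: "integrable \<nu> (\<lambda>x. (wnorm W (moment_vector \<psi> x))\<^sup>2)" "?V \<le> ?S"
    unfolding \<Psi> m_def using \<nu>.variance_form_le[OF W \<Phi>_int form] by auto
  have wnorm_\<Psi>: "(\<lambda>x. (wnorm W (moment_vector \<psi> x))\<^sup>2) \<in> borel_measurable \<Omega>"
    using borel_measurable_moment_vector[of \<psi>, OF \<psi>] by measurable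
  have V_X: "integrable M (\<lambda>s. (wnorm W (moment_vector \<psi> (X i s)))\<^sup>2)"
    "expectation (\<lambda>s. (wnorm W (moment_vector \<psi> (X i s)))\<^sup>2) = ?V" if "i < n" for i
    using V(1) unfolding integrable_distr_eq[OF X[OF that] wnorm_\<Psi>, symmetric]
      integral_distr[OF X[OF that] wnorm_\<Psi>, symmetric] distr[OF that] by auto
  let ?D = "\<lambda>s. \<Sum>i<n. moment_vector \<psi> (X i s)"
  have cross: "integrable M (\<lambda>s. moment_vector \<psi> (X a s) \<bullet> (W *v moment_vector \<psi> (X b s)))"
    "a \<noteq> b \<Longrightarrow> expectation (\<lambda>s. moment_vector \<psi> (X a s) \<bullet> (W *v moment_vector \<psi> (X b s))) = 0"
    if "a < n" "b < n" for a b
  proof -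
    have *: "integrable M (\<lambda>s. moment_vector \<psi> (X a s) \<bullet> (W *v moment_vector \<psi> (X b s))) \<and>
        expectation (\<lambda>s. moment_vector \<psi> (X a s) \<bullet> (W *v moment_vector \<psi> (X b s))) = 0" if "a \<noteq> b"
      using expectation_form_indep_centered[where \<psi> = \<psi> and W = W, OF indep _ _ that \<psi>] \<open>a < n\<close> \<open>b < n\<close> \<psi>_X by auto
    then show "a \<noteq> b \<Longrightarrow> expectation (\<lambda>s. moment_vector \<psi> (X a s) \<bullet> (W *v moment_vector \<psi> (X b s))) = 0"
      by blast
    show "integrable M (\<lambda>s. moment_vector \<psi> (X a s) \<bullet> (W *v moment_vector \<psi> (X b s)))"
      using * V_X(1)[OF \<open>a < n\<close>] by (cases "a = b") (auto simp: wnorm_power2[OF W])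
  qed
  have D: "integrable M (\<lambda>s. (wnorm W (?D s))\<^sup>2)" "expectation (\<lambda>s. (wnorm W (?D s))\<^sup>2) = real n * ?V"
    using expectation_sum_power2_orthogonal[OF W, of "{..<n}" "\<lambda>i s. moment_vector \<psi> (X i s)"] cross V_X(2)
    by auto
  have Z: "Z s = wnorm W (?D s) / real n" for s
  proof -
    have "?D s /\<^sub>R real n = (\<Sum>i<n. moment_vector \<phi> (X i s)) /\<^sub>R real n - m"
      using n by (simp add: \<Psi> sum_subtractf scaleR_diff_right sum_constant_scaleR del: sum_constant)
    then show ?thesis
      using wnorm_scaleR[of W "inverse (real n)" "?D s"] by (simp add: Z_def divide_inverse mult.commute)
  qed
  have Z_meas: "Z \<in> borel_measurable M"
  proof -
    have "(\<lambda>s. moment_vector \<phi> (X i s)) \<in> borel_measurable M" if "i < n" for i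
      by (rule measurable_compose[OF X[OF that] \<Phi>])
    then have "(\<lambda>s. \<Sum>i<n. moment_vector \<phi> (X i s)) \<in> borel_measurable M"
      by (intro borel_measurable_sum) simp
    then show ?thesis unfolding Z_def by measurable
  qed
  have Z2: "integrable M (\<lambda>s. (Z s)\<^sup>2)" "expectation (\<lambda>s. (Z s)\<^sup>2) = ?V / real n"
    using D n by (simp_all add: Z power_divide power2_eq_square[of "real n"])
  show "integrable M Z"
    by (rule square_integrable_imp_integrable[OF Z_meas Z2(1)])
  have "expectation Z \<le> sqrt (?V / real n)"
    using expectation_le_sqrt_second_moment[OF Z_meas Z2(1)] Z2(2) by simp
  also have "\<dots> \<le> sqrt (?S / real n)"
    using V(2) n by (simp add: divide_right_mono)
  finally show "expectation Z \<le> sqrt (?S / real n)" .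
qed

section \<open>The minimum distance estimator\<close>

lemma ennreal_sqrt_ennreal: "0 \<le> r \<Longrightarrow> ennreal_sqrt (ennreal r) = ennreal (sqrt r)"
  by (simp add: ennreal_sqrt_def)

text \<open>
  Here \<open>e\<close> stands for the empirical moments and \<open>m\<close> for the true ones: the distance to \<open>m\<close> and
  the distance to \<open>e\<close> differ by at most \<open>\<parallel>e - m\<parallel>\<close>, and this is spent once for the minimizer
  \<open>\<mu>'\<close> and once for the competitor \<open>\<mu>\<close>.
\<close>

lemma wnorm_minimizer_excess:
  assumes W: "pos_def_matrix W" and min: "wnorm W (\<mu>' - e) \<le> wnorm W (\<mu> - e)"
  shows "wnorm W (\<mu>' - m) \<le> wnorm W (\<mu> - m) + 2 * wnorm W (e - m)"
  using wnorm_triangle[OF W, of \<mu>' m e] wnorm_triangle[OF W, of \<mu> e m] min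
  by (simp add: wnorm_minus_commute[of W m e])


theorem corollary11:
  fixes \<Omega> :: "'a measure"
    and \<nu> :: "'a measure"
    and \<phi> :: "'k::finite \<Rightarrow> 'a \<Rightarrow> real"
    and W :: "real^'k^'k"
    and D\<^sub>G :: "'a measure set"
    and P :: "'b measure"
    and n :: nat
    and X :: "nat \<Rightarrow> 'b \<Rightarrow> 'a"
    and \<mu>hat :: "'b \<Rightarrow> 'a measure"
  assumes "\<nu> \<in> space (prob_algebra \<Omega>)"
    and "D\<^sub>G \<subseteq> space (prob_algebra \<Omega>)"
    and "\<And>k. \<phi> k \<in> borel_measurable \<Omega>"
    and "\<And>\<mu> k. \<mu> \<in> D\<^sub>G \<Longrightarrow> integrable \<mu> (\<phi> k)"
    and "pos_def_matrix W"
    and "n \<ge> 1"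
    and "prob_space P"
    and "prob_space.indep_vars P (\<lambda>_. \<Omega>) X {..<n}"
    and "\<And>i. i < n \<Longrightarrow> distr P \<Omega> (X i) = \<nu>"
    and "\<And>s. s \<in> space P \<Longrightarrow>
           is_arg_min (\<lambda>\<mu>. ipm (moment_class W \<phi>) \<mu> (empirical \<Omega> n (\<lambda>i. X i s)))
             (\<lambda>\<mu>. \<mu> \<in> D\<^sub>G) (\<mu>hat s)"
  shows "(\<forall>s\<in>space P.
            is_arg_min (\<lambda>\<mu>. gmm_objective W \<phi> \<mu> (empirical \<Omega> n (\<lambda>i. X i s)))
              (\<lambda>\<mu>. \<mu> \<in> D\<^sub>G) (\<mu>hat s)) \<and>
         (\<integral>\<^sup>+ s. e2ennreal (ipm (moment_class W \<phi>) (\<mu>hat s) \<nu>) \<partial>P)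
           \<le> e2ennreal (INF \<mu>\<in>D\<^sub>G. ipm (moment_class W \<phi>) \<mu> \<nu>)
             + 4 * ennreal_sqrt
                 ((\<integral>\<^sup>+ x. ennreal (\<Sum>i\<in>UNIV. \<Sum>j\<in>UNIV. W $ i $ j * \<phi> i x * \<phi> j x) \<partial>\<nu>) / of_nat n)"
proof -
  let ?m = "\<lambda>\<mu>. \<integral>x. moment_vector \<phi> x \<partial>\<mu>"
  let ?e = "\<lambda>s. empirical \<Omega> n (\<lambda>i. X i s)"
  interpret P: prob_space P by fact
  interpret \<nu>: prob_space \<nu>
    using \<open>\<nu> \<in> space (prob_algebra \<Omega>)\<close> by (simp add: space_prob_algebra)
  have W: "pos_def_matrix W" and n: "0 < n" by (fact, use \<open>n \<ge> 1\<close> in simp)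
  note \<phi> = \<open>\<And>k. \<phi> k \<in> borel_measurable \<Omega>\<close>
  note \<phi>_int = \<open>\<And>\<mu> k. \<mu> \<in> D\<^sub>G \<Longrightarrow> integrable \<mu> (\<phi> k)\<close>
  note indep = \<open>P.indep_vars (\<lambda>_. \<Omega>) X {..<n}\<close>
  note argmin = \<open>\<And>s. s \<in> space P \<Longrightarrow> is_arg_min (\<lambda>\<mu>. ipm (moment_class W \<phi>) \<mu> (?e s)) (\<lambda>\<mu>. \<mu> \<in> D\<^sub>G) (\<mu>hat s)\<close>
  have X_space: "X i s \<in> space \<Omega>" if "i < n" "s \<in> space P" for i s
    using indep that by (auto simp: P.indep_vars_def dest: measurable_space)
  have ipm_emp: "ipm (moment_class W \<phi>) \<mu> (?e s) = ereal (wnorm W (?m \<mu> - ?m (?e s)))"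
    if "\<mu> \<in> D\<^sub>G" "s \<in> space P" for \<mu> s
    by (intro ipm_moment_class[OF W] \<phi>_int integrable_empirical[OF n _ \<phi>] X_space that)
  have \<mu>hat: "\<mu>hat s \<in> D\<^sub>G" if "s \<in> space P" for s
    using argmin[OF that] by (simp add: is_arg_min_def)
  have min: "wnorm W (?m (\<mu>hat s) - ?m (?e s)) \<le> wnorm W (?m \<mu> - ?m (?e s))"
    if "s \<in> space P" "\<mu> \<in> D\<^sub>G" for s \<mu>
    using argmin[OF that(1)] that by (auto simp: is_arg_min_def ipm_emp not_less)
  have gmm: "is_arg_min (\<lambda>\<mu>. gmm_objective W \<phi> \<mu> (?e s)) (\<lambda>\<mu>. \<mu> \<in> D\<^sub>G) (\<mu>hat s)"
    if s: "s \<in> space P" for s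
    unfolding is_arg_min_linorder gmm_objective_eq_wnorm[OF W]
    using \<mu>hat[OF s] min[OF s] by (auto intro!: power_mono wnorm_nonneg[OF W])

  let ?f = "\<lambda>x. (wnorm W (moment_vector \<phi> x))\<^sup>2"
  let ?S = "\<integral>\<^sup>+ x. ennreal (\<Sum>i\<in>UNIV. \<Sum>j\<in>UNIV. W $ i $ j * \<phi> i x * \<phi> j x) \<partial>\<nu>"
  let ?risk = "\<integral>\<^sup>+ s. e2ennreal (ipm (moment_class W \<phi>) (\<mu>hat s) \<nu>) \<partial>P"
  let ?best = "INF \<mu>\<in>D\<^sub>G. ipm (moment_class W \<phi>) \<mu> \<nu>"
  have S_eq: "?S = (\<integral>\<^sup>+ x. ennreal (?f x) \<partial>\<nu>)"
    by (simp add: wnorm_power2[OF W] moment_form_eq_sum)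
  have "?risk \<le> e2ennreal ?best + 4 * ennreal_sqrt (?S / of_nat n)"
  proof (cases "?S = \<top>")
    case True
    then have "?S / of_nat n = \<top>" by (simp add: ennreal_top_divide)
    then have "4 * ennreal_sqrt (?S / of_nat n) = \<top>"
      by (simp add: ennreal_sqrt_def ennreal_mult_top)
    then show ?thesis by simp
  next
    case False
    have \<phi>': "\<phi> k \<in> borel_measurable \<nu>" for k
      using \<phi>[of k] \<open>\<nu> \<in> space (prob_algebra \<Omega>)\<close>
      by (simp add: space_prob_algebra cong: measurable_cong_sets)
    have form: "integrable \<nu> ?f"
    proof (rule integrableI_nonneg)
      show "?f \<in> borel_measurable \<nu>"
        using borel_measurable_moment_vector[of \<phi>, OF \<phi>'] by measurable
    qed (use False in \<open>auto simp: S_eq less_top\<close>)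
    let ?r = "sqrt (integral\<^sup>L \<nu> ?f / real n)"
    have sqrt_S: "ennreal_sqrt (?S / of_nat n) = ennreal ?r"
    proof -
      have "?S / of_nat n = ennreal (integral\<^sup>L \<nu> ?f / real n)"
        using n by (simp add: S_eq nn_integral_eq_integral[OF form] divide_ennreal ennreal_of_nat_eq_real_of_nat)
      then show ?thesis by (simp add: ennreal_sqrt_ennreal)
    qed
    define Z where "Z s = wnorm W (?m (?e s) - ?m \<nu>)" for s
    let ?Z = "\<lambda>s. wnorm W ((\<Sum>i<n. moment_vector \<phi> (X i s)) /\<^sub>R real n - ?m \<nu>)"
    have Z_eq: "Z s = ?Z s" if "s \<in> space P" for s
      unfolding Z_def
      by (subst integral_empirical[OF n X_space[OF _ that] borel_measurable_moment_vector[of \<phi>, OF \<phi>]]) auto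
    have "integrable P ?Z" "P.expectation ?Z \<le> ?r"
      using P.expectation_wnorm_empirical_mean[OF W n indep _ \<phi> form] assms(9) by auto
    then have Z: "integrable P Z" "P.expectation Z \<le> ?r"
      by (simp_all add: Z_eq cong: Bochner_Integration.integrable_cong Bochner_Integration.integral_cong)
    have ipm_\<nu>: "ipm (moment_class W \<phi>) \<mu> \<nu> = ereal (wnorm W (?m \<mu> - ?m \<nu>))" if "\<mu> \<in> D\<^sub>G" for \<mu>
      by (intro ipm_moment_class[OF W] \<phi>_int \<nu>.integrable_of_form[OF W \<phi>' form] that)
    obtain s\<^sub>0 where s0: "s\<^sub>0 \<in> space P" using P.not_empty by blast
    \<comment> \<open>The infimum lies between zero and a finite value, hence it can be handled as a real number.\<close>
    have best_nonneg: "0 \<le> ?best"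
      by (rule INF_greatest) (simp add: ipm_\<nu> wnorm_nonneg[OF W])
    have "?best \<le> ereal (wnorm W (?m (\<mu>hat s\<^sub>0) - ?m \<nu>))"
      using \<mu>hat[OF s0] by (intro INF_lower2[of "\<mu>hat s\<^sub>0"]) (simp_all add: ipm_\<nu>)
    with best_nonneg obtain b where b: "?best = ereal b" "0 \<le> b"
      by (cases ?best) auto
    have excess: "wnorm W (?m (\<mu>hat s) - ?m \<nu>) \<le> b + 2 * Z s" if s: "s \<in> space P" for s
    proof -
      have "ereal (wnorm W (?m (\<mu>hat s) - ?m \<nu>) - 2 * Z s) \<le> ?best"
      proof (rule INF_greatest)
        fix \<mu> assume "\<mu> \<in> D\<^sub>G"
        then show "ereal (wnorm W (?m (\<mu>hat s) - ?m \<nu>) - 2 * Z s) \<le> ipm (moment_class W \<phi>) \<mu> \<nu>"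
          using wnorm_minimizer_excess[OF W min[OF s], of \<mu> "?m \<nu>"] by (simp add: ipm_\<nu> Z_def)
      qed
      then show ?thesis by (simp add: b)
    qed
    \<comment> \<open>The loss of the estimator may fail to be measurable in \<open>s\<close>. The nonnegative integral is
      monotone nevertheless, and the bound is measurable.\<close>
    have "?risk \<le> (\<integral>\<^sup>+ s. ennreal (b + 2 * Z s) \<partial>P)"
      by (intro nn_integral_mono) (simp add: ipm_\<nu> \<mu>hat excess ennreal_leI)
    also have "\<dots> = ennreal (b + 2 * P.expectation Z)"
    proof -
      have "0 \<le> Z s" for s by (simp add: Z_def wnorm_nonneg[OF W])
      then show ?thesis
        using Z(1) b(2) by (subst nn_integral_eq_integral) (auto simp: P.prob_space)
    qed
    also have "\<dots> \<le> ennreal (b + 4 * ?r)"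
    proof (rule ennreal_leI)
      have "0 \<le> ?r" by simp
      then show "b + 2 * P.expectation Z \<le> b + 4 * ?r" using Z(2) by linarith
    qed
    also have "\<dots> = e2ennreal ?best + 4 * ennreal_sqrt (?S / of_nat n)"
      unfolding sqrt_S b(1) using b(2) by (simp add: ennreal_plus ennreal_mult flip: ennreal_numeral)
    finally show ?thesis .
  qed
  with gmm show ?thesis by blast
qed

end
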